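(* Let $t\in\mathbb{T}$, $\gamma>1$, $K\ge1$, and let $B$ be a Blaschke product whose zero set satisfies $Z(B)\subset R(t,\gamma,K)$. Then $B'\in H^p$ for all $0<p<\frac{1}{2\gamma}$.
   Context: $\mathbb{D}$ is the open unit disk in $\mathbb{C}$, $\mathbb{T}$ the unit circle, and $H^p$ is the classical Hardy space on $\mathbb{D}$. Blaschke product: for a sequence $\{z_n\}_{n\ge1}\subset\mathbb{D}$ (repetitions allowed) with $\sum_{n=1}^\infty(1-|z_n|)<\infty$, $$B(z)=\prod_{n=1}^\infty b_n(z),\qquad b_n(z)=\frac{\overline{z_n}}{|z_n|}\,\frac{z_n-z}{1-\overline{z_n}z},$$ and $Z(B)=\{z_n\}$ is its zero set. Standing assumption: $B(0)\neq0$, i.e. all $z_n\ne0$. For $t\in\mathbb{T}$, $\gamma\ge1$, $K\ge1$: $R(t,\gamma,K)=\{\lambda\in\mathbb{D}:\ |t-\lambda|^{\gamma}\le K(1-|\lambda|)\}$. *)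

theory Defs
  imports "HOL-Complex_Analysis.Complex_Analysis"
begin

definition region :: "complex \<Rightarrow> real \<Rightarrow> real \<Rightarrow> complex set" where
  "region t \<gamma> K = {w \<in> ball 0 1. norm (t - w) powr \<gamma> \<le> K * (1 - norm w)}"

text \<open>Repetitions are allowed, so zeros may be multiple. The condition \<open>a n \<noteq> 0\<close> expresses that
  the Blaschke product does not vanish at the origin.\<close>

definition blaschke_sequence :: "(nat \<Rightarrow> complex) \<Rightarrow> bool" where
  "blaschke_sequence a \<longleftrightarrow>
     (\<forall>n. a n \<in> ball 0 1 \<and> a n \<noteq> 0) \<and> summable (\<lambda>n. 1 - norm (a n))"

definition blaschke_factor :: "complex \<Rightarrow> complex \<Rightarrow> complex" where
  "blaschke_factor a z = (cnj a / of_real (norm a)) * ((a - z) / (1 - cnj a * z))"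

definition blaschke_product :: "(nat \<Rightarrow> complex) \<Rightarrow> complex \<Rightarrow> complex" where
  "blaschke_product a z = (\<Prod>n. blaschke_factor (a n) z)"

text \<open>The Hardy space \<open>H\<^sup>p\<close> of the unit disk, for \<open>0 < p < \<infinity>\<close>. Values outside the open disk
  are irrelevant. The integrands are continuous, so the integrals exist.\<close>

definition hardy_space :: "real \<Rightarrow> (complex \<Rightarrow> complex) set" where
  "hardy_space p = {f. f holomorphic_on ball 0 1 \<and>
     bdd_above ((\<lambda>r. 1 / (2 * pi) *
       integral {0..2 * pi} (\<lambda>\<theta>. norm (f (of_real r * cis \<theta>)) powr p)) ` {0..<1})}"

end

theory Submission
  imports Defs
begin

text \<open>
  Two estimates carry the proof. Write \<open>d = \<bar>1 - cnj w * z\<bar>\<close> for a zero \<open>w\<close> and a point \<open>z\<close> of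
  the disk. As \<open>d \<ge> 1 - \<bar>w\<bar>\<close>, membership of \<open>w\<close> in the region gives \<open>\<bar>t - w\<bar> powr \<gamma> \<le> K * d\<close>,
  while \<open>\<bar>t - z\<bar> = \<bar>1 - cnj t * z\<bar> \<le> d + \<bar>t - w\<bar>\<close>. Hence \<open>\<bar>t - z\<bar> powr \<gamma> \<le> C * d\<close> with \<open>C\<close>
  independent of \<open>w\<close> and \<open>z\<close> (\<open>norm_powr_le_of_region\<close>): the denominators of all Blaschke factors
  are controlled by the distance from \<open>z\<close> to the single boundary point \<open>t\<close>.

  All factors are bounded by \<open>1\<close>, so the derivative of the product is bounded by the sum of the
  moduli \<open>(1 - \<bar>w\<bar>\<^sup>2) / d\<^sup>2\<close> of the derivatives of the factors
  (\<open>norm_deriv_blaschke_product_le\<close>). With the first estimate and the Blaschke condition this is \<open>O(\<bar>t - z\<bar> powr (-2 * \<gamma>))\<close>.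
  A function of this growth lies in \<open>H\<^sup>p\<close> as soon as \<open>2 * \<gamma> * p < 1\<close>, since
  \<open>\<bar>t - cis \<theta>\<bar> powr (-s)\<close> is integrable for \<open>s < 1\<close> and \<open>\<bar>t - cis \<theta>\<bar> \<le> 2 * \<bar>t - r * cis \<theta>\<bar>\<close>
  makes this bound uniform in \<open>r\<close> (\<open>hardy_space_of_point_growth\<close>).
\<close>

section \<open>Blaschke factors and products\<close>

lemma one_minus_norm_le_norm_one_minus_cnj_mult:
  fixes w z :: complex
  assumes "norm z \<le> 1"
  shows "1 - norm w \<le> norm (1 - cnj w * z)"
proof -
  have "norm (cnj w * z) \<le> norm w"
    using assms by (simp add: norm_mult mult_left_le)
  thus ?thesis
    using norm_triangle_ineq2[of 1 "cnj w * z"] by simp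
qed

lemma one_minus_cnj_mult_nonzero:
  fixes w z :: complex
  assumes "norm w < 1" "norm z < 1"
  shows "1 - cnj w * z \<noteq> 0"
  using one_minus_norm_le_norm_one_minus_cnj_mult[of z w] assms by auto

lemma norm_blaschke_factor_le_1:
  assumes "norm w < 1" "w \<noteq> 0" "norm z < 1"
  shows "norm (blaschke_factor w z) \<le> 1"
proof -
  have "norm (blaschke_factor w z) = norm (Moebius_function 0 w z)"
    using assms by (simp add: blaschke_factor_def Moebius_function_def norm_mult norm_divide
      norm_minus_commute)
  thus ?thesis
    using Moebius_function_norm_lt_1[OF assms(1,3), of 0] by simp
qed

lemma has_field_derivative_blaschke_factor:
  assumes "norm w < 1" "norm z < 1"
  shows "(blaschke_factor w has_field_derivative
           cnj w / of_real (norm w) * (- (1 - of_real (norm w ^ 2)) / (1 - cnj w * z) ^ 2)) (at z)"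
proof -
  have nz: "1 - cnj w * z \<noteq> 0"
    using one_minus_cnj_mult_nonzero[OF assms] .
  have sq: "complex_of_real (norm w) * of_real (norm w) = w * cnj w"
    using complex_norm_square[of w] by (simp add: power2_eq_square)
  have "((\<lambda>z. (w - z) / (1 - cnj w * z)) has_field_derivative
          (- (1 - of_real (norm w ^ 2)) / (1 - cnj w * z) ^ 2)) (at z)"
    by (rule derivative_eq_intros refl nz)+
       (simp add: sq power2_eq_square algebra_simps)
  from DERIV_cmult[OF this, of "cnj w / of_real (norm w)"] show ?thesis
    unfolding blaschke_factor_def[abs_def] by simp
qed

text \<open>
  The unimodular constant in the factor makes the numerator of \<open>blaschke_factor w z - 1\<close> divisible
  by \<open>1 - \<bar>w\<bar>\<close>. The Blaschke condition is therefore what the M-test needs for locally uniform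
  convergence of the product.
\<close>

lemma norm_blaschke_factor_minus_1_le:
  assumes "norm w < 1" "w \<noteq> 0" "norm z \<le> r" "r < 1"
  shows "norm (blaschke_factor w z - 1) \<le> 2 / (1 - r) * (1 - norm w)"
proof -
  have z: "norm z < 1" using assms by linarith
  have nz: "1 - cnj w * z \<noteq> 0"
    using one_minus_cnj_mult_nonzero[OF assms(1) z] .
  define m :: complex where "m = of_real (norm w)"
  have m: "m \<noteq> 0" "cnj w * w = m ^ 2"
    using assms complex_norm_square[of w] by (auto simp: m_def mult.commute)
  have eq: "blaschke_factor w z - 1 = - ((1 - m) * (m + cnj w * z)) / (m * (1 - cnj w * z))"
  proof -
    have "blaschke_factor w z - 1 = (cnj w * (w - z) - m * (1 - cnj w * z)) / (m * (1 - cnj w * z))"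
      using nz m unfolding blaschke_factor_def m_def[symmetric] by (simp add: divide_simps)
    also have "cnj w * (w - z) - m * (1 - cnj w * z) = - ((1 - m) * (m + cnj w * z))"
      using m by (simp add: algebra_simps power2_eq_square)
    finally show ?thesis .
  qed
  have num: "norm (m + cnj w * z) \<le> norm w * 2"
  proof -
    have "norm (m + cnj w * z) \<le> norm w + norm w * norm z"
      using norm_triangle_ineq[of m "cnj w * z"] by (simp add: m_def norm_mult)
    also have "\<dots> \<le> norm w * 2"
      using z mult_left_mono[of "norm z" 1 "norm w"] by simp
    finally show ?thesis .
  qed
  have den: "1 - r \<le> norm (1 - cnj w * z)"
    using one_minus_norm_le_norm_one_minus_cnj_mult[of "cnj w" "cnj z"] assms
    by (simp add: mult.commute)
  have nm: "norm (1 - m) = 1 - norm w" "norm m = norm w"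
  proof -
    have "1 - m = of_real (1 - norm w)" by (simp add: m_def)
    thus "norm (1 - m) = 1 - norm w"
      using assms by (simp only: norm_of_real)
  qed (simp add: m_def)
  have "norm (blaschke_factor w z - 1)
          = (1 - norm w) * norm (m + cnj w * z) / (norm w * norm (1 - cnj w * z))"
    unfolding eq by (simp add: norm_divide norm_mult nm)
  also have "\<dots> \<le> (1 - norm w) * (norm w * 2) / (norm w * (1 - r))"
    using assms num den by (intro frac_le mult_left_mono mult_nonneg_nonneg mult_pos_pos) auto
  also have "\<dots> = 2 / (1 - r) * (1 - norm w)"
    using assms by simp
  finally show ?thesis .
qed

lemma uniform_limit_blaschke_product:
  assumes a: "blaschke_sequence a" and r: "r < 1"
  shows "uniform_limit (cball 0 r) (\<lambda>N z. \<Prod>n<N. blaschke_factor (a n) z)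
           (blaschke_product a) sequentially"
proof -
  have an: "norm (a n) < 1" "a n \<noteq> 0" for n
    using a by (auto simp: blaschke_sequence_def)
  have sum: "summable (\<lambda>n. 2 / (1 - r) * (1 - norm (a n)))"
    by (intro summable_mult) (use a in \<open>auto simp: blaschke_sequence_def\<close>)
  have bound: "norm (blaschke_factor (a n) z - 1) \<le> 2 / (1 - r) * (1 - norm (a n))"
    if "z \<in> cball 0 r" for n z
    using that norm_blaschke_factor_minus_1_le[OF an(1) an(2), of z r n] r by auto
  have "uniformly_convergent_on (cball 0 r) (\<lambda>N z. \<Prod>n<N. blaschke_factor (a n) z)"
  proof (rule uniformly_convergent_on_prod')
    show "continuous_on (cball 0 r) (blaschke_factor (a n))" for n
    proof (rule continuous_at_imp_continuous_on, rule ballI)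
      fix z :: complex assume "z \<in> cball 0 r"
      hence "norm z < 1" using r by simp
      from has_field_derivative_blaschke_factor[OF an(1) this]
      show "isCont (blaschke_factor (a n)) z" by (rule DERIV_isCont)
    qed
    show "uniformly_convergent_on (cball 0 r) (\<lambda>N z. \<Sum>n<N. norm (blaschke_factor (a n) z - 1))"
      by (rule Weierstrass_m_test'[OF _ sum]) (use bound in auto)
  qed auto
  then obtain g where g: "uniform_limit (cball 0 r)
      (\<lambda>N z. \<Prod>n<N. blaschke_factor (a n) z) g sequentially"
    by (auto simp: uniformly_convergent_on_def)
  have "g z = blaschke_product a z" if z: "z \<in> cball 0 r" for z :: complex
  proof -
    have "summable (\<lambda>n. norm (blaschke_factor (a n) z - 1))"
      by (rule summable_comparison_test'[OF sum]) (use bound[OF z] in auto)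
    hence "convergent_prod (\<lambda>n. blaschke_factor (a n) z)"
      by (intro abs_convergent_prod_imp_convergent_prod summable_imp_abs_convergent_prod)
    hence "(\<lambda>N. \<Prod>n\<le>N. blaschke_factor (a n) z) \<longlonglongrightarrow> blaschke_product a z"
      unfolding blaschke_product_def by (rule convergent_prod_LIMSEQ)
    hence "(\<lambda>N. \<Prod>n<N. blaschke_factor (a n) z) \<longlonglongrightarrow> blaschke_product a z"
      unfolding lessThan_Suc_atMost[symmetric] by (rule LIMSEQ_imp_Suc)
    moreover have "(\<lambda>N. \<Prod>n<N. blaschke_factor (a n) z) \<longlonglongrightarrow> g z"
      using g z by (rule tendsto_uniform_limitI)
    ultimately show ?thesis
      by (rule LIMSEQ_unique[symmetric])
  qed
  from uniform_limit_cong'[THEN iffD1, OF refl this g] show ?thesis .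
qed

lemma locally_uniform_limit_blaschke_product:
  assumes a: "blaschke_sequence a" and x: "x \<in> ball 0 1"
  shows "\<exists>d. 0 < d \<and> cball x d \<subseteq> ball 0 1 \<and> uniform_limit (cball x d)
           (\<lambda>N z. \<Prod>n<N. blaschke_factor (a n) z) (blaschke_product a) sequentially"
proof -
  define d where "d = (1 - norm x) / 2"
  have sub: "cball x d \<subseteq> cball 0 (norm x + d)"
  proof
    fix y assume "y \<in> cball x d"
    thus "y \<in> cball 0 (norm x + d)"
      using norm_triangle_sub[of y x] by (simp add: dist_norm norm_minus_commute)
  qed
  have d: "0 < d" "norm x + d < 1"
    using x by (auto simp: d_def field_simps)
  show ?thesis
  proof (intro exI conjI)
    show "cball x d \<subseteq> ball 0 1"
      using sub d by force
    show "uniform_limit (cball x d) (\<lambda>N z. \<Prod>n<N. blaschke_factor (a n) z)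
            (blaschke_product a) sequentially"
      by (rule uniform_limit_on_subset[OF uniform_limit_blaschke_product[OF a d(2)] sub])
  qed fact
qed

lemma holomorphic_on_blaschke_product:
  assumes a: "blaschke_sequence a"
  shows "blaschke_product a holomorphic_on ball 0 1"
proof (rule holomorphic_uniform_sequence[OF open_ball])
  show "(\<lambda>z. \<Prod>n<N. blaschke_factor (a n) z) holomorphic_on ball 0 1" for N
  proof (rule holomorphic_on_prod)
    fix n
    show "blaschke_factor (a n) holomorphic_on ball 0 1"
      unfolding holomorphic_on_open[OF open_ball]
      by (intro ballI exI, rule has_field_derivative_blaschke_factor)
         (use a in \<open>auto simp: blaschke_sequence_def\<close>)
  qed
qed (rule locally_uniform_limit_blaschke_product[OF a])

text \<open>
  In the product rule each summand is one derivative times factors bounded by \<open>1\<close>. Locally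
  uniform convergence carries this bound from the partial products to the limit.
\<close>

lemma norm_deriv_blaschke_product_le:
  assumes a: "blaschke_sequence a" and z: "norm z < 1"
    and M: "\<And>N. (\<Sum>n<N. (1 - norm (a n) ^ 2) / norm (1 - cnj (a n) * z) ^ 2) \<le> M"
  shows "norm (deriv (blaschke_product a) z) \<le> M"
proof -
  have an: "norm (a n) < 1" "a n \<noteq> 0" for n
    using a by (auto simp: blaschke_sequence_def)
  define D where "D n z = cnj (a n) / of_real (norm (a n)) *
      (- (1 - of_real (norm (a n) ^ 2)) / (1 - cnj (a n) * z) ^ 2)" for n z
  define D' where "D' N z = (\<Sum>n<N. D n z * (\<Prod>k\<in>{..<N} - {n}. blaschke_factor (a k) z))" for N z
  have der: "((\<lambda>z. \<Prod>n<N. blaschke_factor (a n) z) has_field_derivative D' N z) (at z)"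
    if "z \<in> ball 0 1" for N z
    unfolding D'_def D_def
    by (rule has_field_derivative_prod, rule has_field_derivative_blaschke_factor)
       (use that an in auto)
  from has_complex_derivative_uniform_sequence[OF open_ball der
    locally_uniform_limit_blaschke_product[OF a]]
  obtain g' where g': "\<And>x. x \<in> ball 0 1 \<Longrightarrow> (blaschke_product a has_field_derivative g' x) (at x)"
    "\<And>x. x \<in> ball 0 1 \<Longrightarrow> (\<lambda>N. D' N x) \<longlonglongrightarrow> g' x" by blast
  have "norm (D' N z) \<le> M" for N
  proof -
    have "norm (D' N z) \<le> (\<Sum>n<N. norm (D n z * (\<Prod>k\<in>{..<N} - {n}. blaschke_factor (a k) z)))"
      unfolding D'_def by (rule norm_sum)
    also have "\<dots> \<le> (\<Sum>n<N. norm (D n z))"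
    proof (rule sum_mono)
      fix n
      have "norm (\<Prod>k\<in>{..<N} - {n}. blaschke_factor (a k) z) \<le> 1"
        unfolding prod_norm[symmetric]
        by (rule prod_le_1) (use norm_blaschke_factor_le_1 an z in auto)
      thus "norm (D n z * (\<Prod>k\<in>{..<N} - {n}. blaschke_factor (a k) z)) \<le> norm (D n z)"
        by (simp add: norm_mult mult_left_le)
    qed
    also have "\<dots> = (\<Sum>n<N. (1 - norm (a n) ^ 2) / norm (1 - cnj (a n) * z) ^ 2)"
    proof (rule sum.cong)
      fix n
      have "norm (1 - of_real (norm (a n) ^ 2) :: complex) = \<bar>1 - norm (a n) ^ 2\<bar>"
        by (metis norm_of_real of_real_1 of_real_diff)
      also have "\<dots> = 1 - norm (a n) ^ 2"
        using an[of n] by (simp add: power_le_one)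
      finally have "norm (1 - of_real (norm (a n) ^ 2) :: complex) = 1 - norm (a n) ^ 2" .
      thus "norm (D n z) = (1 - norm (a n) ^ 2) / norm (1 - cnj (a n) * z) ^ 2"
        using an[of n] by (simp only: D_def norm_mult norm_divide norm_power norm_minus_cancel) simp
    qed simp
    finally show ?thesis using M[of N] by linarith
  qed
  hence "norm (g' z) \<le> M"
    using tendsto_norm[OF g'(2)[of z]] z by (intro LIMSEQ_le_const2[of "\<lambda>N. norm (D' N z)"]) auto
  thus "norm (deriv (blaschke_product a) z) \<le> M"
    using g'(1)[of z] z by (simp add: DERIV_imp_deriv)
qed


section \<open>Zeros in a tangential approach region\<close>

text \<open>
  If \<open>d\<close> dominates \<open>\<bar>t - w\<bar>\<close>, then \<open>z\<close> is at distance \<open>O(d)\<close> from \<open>t\<close>, which is better than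
  needed because \<open>d \<le> 2\<close>; otherwise \<open>\<bar>t - z\<bar>\<close> is of the order of \<open>\<bar>t - w\<bar>\<close>, whose power \<open>\<gamma>\<close> the
  region bounds by \<open>K * d\<close>. The constant covers both cases.
\<close>

lemma norm_powr_le_of_region:
  assumes t: "norm t = 1" and \<gamma>: "\<gamma> \<ge> 1" and K: "K \<ge> 0"
    and w: "w \<in> region t \<gamma> K" and z: "norm z \<le> 1"
  shows "norm (t - z) powr \<gamma> \<le> 2 powr \<gamma> * (2 powr \<gamma> + K) * norm (1 - cnj w * z)"
proof -
  define d where "d = norm (1 - cnj w * z)"
  define e where "e = norm (t - w)"
  have w1: "norm w < 1" and e: "e powr \<gamma> \<le> K * (1 - norm w)"
    using w by (auto simp: region_def e_def)
  have "1 - norm w \<le> d"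
    unfolding d_def by (rule one_minus_norm_le_norm_one_minus_cnj_mult[OF z])
  hence d0: "d > 0" and e: "e powr \<gamma> \<le> K * d"
    using w1 e mult_left_mono[OF _ K, of "1 - norm w" d] by auto
  have d2: "d \<le> 2"
  proof -
    have "norm (cnj w * z) \<le> 1"
      using z w1 by (simp add: norm_mult mult_le_one)
    thus ?thesis
      using norm_triangle_ineq4[of 1 "cnj w * z"] by (simp add: d_def)
  qed
  \<comment> \<open>For \<open>\<gamma> \<ge> 1\<close> the surplus power \<open>\<gamma> - 1\<close> of \<open>d \<le> 2\<close> is bounded.\<close>
  have dg: "d powr \<gamma> \<le> 2 powr \<gamma> * d"
  proof -
    have "d powr \<gamma> = d powr (\<gamma> - 1) * d"
      using d0 by (simp add: powr_diff)
    also have "\<dots> \<le> 2 powr (\<gamma> - 1) * d"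
      using d0 d2 \<gamma> by (intro mult_right_mono powr_mono2) auto
    also have "\<dots> \<le> 2 powr \<gamma> * d"
      using d0 by (intro mult_right_mono powr_mono) auto
    finally show ?thesis .
  qed
  have "norm (t - z) \<le> d + e"
  proof -
    have tt: "t * cnj t = 1"
      using t complex_norm_square[of t] by simp
    have "t - z = t * (1 - cnj t * z)"
      by (simp only: right_diff_distrib mult_1_right tt flip: mult.assoc) simp
    hence "norm (t - z) = norm ((1 - cnj w * z) - cnj (t - w) * z)"
      using t by (simp add: norm_mult left_diff_distrib)
    also have "\<dots> \<le> d + norm (cnj (t - w) * z)"
      unfolding d_def by (rule norm_triangle_ineq4)
    also have "norm (cnj (t - w) * z) \<le> e"
      unfolding e_def norm_mult complex_mod_cnj using z by (simp add: mult_left_le)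
    finally show ?thesis by simp
  qed
  also have "d + e \<le> 2 * max d e" by auto
  finally have "norm (t - z) powr \<gamma> \<le> (2 * max d e) powr \<gamma>"
    using \<gamma> by (intro powr_mono2) auto
  also have "\<dots> = 2 powr \<gamma> * (max d e) powr \<gamma>"
    using d0 by (intro powr_mult)
  also have "(max d e) powr \<gamma> \<le> d powr \<gamma> + e powr \<gamma>"
    by (auto simp: max_def)
  also have "\<dots> \<le> (2 powr \<gamma> + K) * d"
    using dg e by (simp add: algebra_simps)
  finally show ?thesis
    unfolding d_def by (simp add: mult.assoc)
qed


section \<open>Growth at one boundary point and Hardy spaces\<close>

lemma integrable_abs_powr:
  fixes s c :: real
  assumes "s < 1" "l \<le> u"
  shows "(\<lambda>x. \<bar>x - c\<bar> powr - s) integrable_on {l..u}"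
proof -
  \<comment> \<open>As \<open>1 - s > 0\<close>, this antiderivative is continuous across the singularity \<open>c\<close>.\<close>
  define F where "F x = sgn (x - c) * \<bar>x - c\<bar> powr (1 - s) / (1 - s)" for x
  have F1: "F x = ((if x \<le> c then - ((c - x) powr (1 - s)) else (x - c) powr (1 - s))) / (1 - s)" for x
    using assms by (auto simp: F_def sgn_if)
  have "continuous_on UNIV (\<lambda>x. if x \<le> c then - ((c - x) powr (1 - s)) else (x - c) powr (1 - s))"
  proof -
    have *: "{x. x \<le> c} = {..c}" "{x. x \<ge> c} = {c..}" "UNIV = {..c} \<union> {c..}" by auto
    show ?thesis unfolding *(3)
      by (rule continuous_on_If) (use assms in \<open>auto intro!: continuous_intros continuous_on_powr'\<close>)
  qed
  hence cont: "continuous_on {l..u} F"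
    unfolding F1[abs_def] using assms
    by (intro continuous_on_divide) (auto intro: continuous_on_subset)
  have "((\<lambda>x. \<bar>x - c\<bar> powr - s) has_integral (F u - F l)) {l..u}"
  proof (rule fundamental_theorem_of_calculus_strong[of "{c}"])
    fix x assume x: "x \<in> {l..u} - {c}"
    have "(F has_field_derivative \<bar>x - c\<bar> powr - s) (at x)"
    proof (cases "x < c")
      case True
      have "((\<lambda>x. - ((c - x) powr (1 - s)) / (1 - s)) has_field_derivative \<bar>x - c\<bar> powr - s) (at x)"
      proof -
        have "((\<lambda>x. - ((c - x) powr (1 - s)) / (1 - s)) has_field_derivative
                - ((1 - s) * (c - x) powr (1 - s - of_nat 1) * (0 - 1)) / (1 - s)) (at x)"
          by (intro DERIV_cdivide DERIV_minus DERIV_fun_powr DERIV_diff DERIV_const DERIV_ident)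
             (use True in auto)
        thus ?thesis using True assms by simp
      qed
      thus ?thesis
        by (rule DERIV_cong_ev[THEN iffD1, rotated -1])
           (use True in \<open>auto simp: F1 intro!: eventually_mono[OF eventually_nhds_in_open[of "{..<c}"]]\<close>)
    next
      case False
      hence x: "c < x" using x by auto
      have "((\<lambda>x. ((x - c) powr (1 - s)) / (1 - s)) has_field_derivative \<bar>x - c\<bar> powr - s) (at x)"
      proof -
        have "((\<lambda>x. (x - c) powr (1 - s) / (1 - s)) has_field_derivative
                (1 - s) * (x - c) powr (1 - s - of_nat 1) * (1 - 0) / (1 - s)) (at x)"
          by (intro DERIV_cdivide DERIV_fun_powr DERIV_diff DERIV_const DERIV_ident)
             (use x in auto)
        thus ?thesis using x assms by simp
      qed
      thus ?thesis
        by (rule DERIV_cong_ev[THEN iffD1, rotated -1])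
           (use x in \<open>auto simp: F1 intro!: eventually_mono[OF eventually_nhds_in_open[of "{c<..}"]]\<close>)
    qed
    thus "(F has_vector_derivative \<bar>x - c\<bar> powr - s) (at x)"
      by (simp add: has_real_derivative_iff_has_vector_derivative)
  qed (use assms cont in auto)
  thus ?thesis by blast
qed

text \<open>
  The cubic Taylor bound \<open>\<bar>sin y - y\<bar> \<le> \<bar>y\<bar> ^ 3 / 6\<close> is at most \<open>\<bar>y\<bar> / 2\<close> as long as \<open>y\<^sup>2 \<le> 3\<close>, and
  \<open>\<pi> / 2 < 17 / 10 < sqrt 3\<close>.
\<close>

lemma abs_sin_ge_half_abs:
  fixes y :: real
  assumes "\<bar>y\<bar> \<le> pi / 2"
  shows "\<bar>sin y\<bar> \<ge> \<bar>y\<bar> / 2"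
proof -
  have "\<bar>sin y - (\<Sum>m<3. sin_coeff m * y ^ m)\<bar> \<le> inverse (fact 3) * \<bar>y\<bar> ^ 3"
    by (rule Maclaurin_sin_bound)
  hence *: "\<bar>sin y - y\<bar> \<le> \<bar>y\<bar> ^ 3 / 6"
    by (simp add: sin_coeff_def eval_nat_numeral)
  have "\<bar>y\<bar> \<le> 17 / 10" using assms pi_less_4 pi_approx by simp
  hence "\<bar>y\<bar> * \<bar>y\<bar> \<le> 17 / 10 * (17 / 10)"
    by (intro mult_mono) auto
  hence "\<bar>y\<bar> * (\<bar>y\<bar> * \<bar>y\<bar>) \<le> \<bar>y\<bar> * 3"
    by (intro mult_left_mono) auto
  hence "\<bar>y\<bar> ^ 3 \<le> 3 * \<bar>y\<bar>" by (simp add: eval_nat_numeral)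
  with * show ?thesis by linarith
qed

text \<open>
  For \<open>\<phi> \<in> (-\<pi>, \<pi>]\<close> and \<open>\<theta> \<in> [0, 2\<pi>]\<close> the difference \<open>\<theta> - \<phi>\<close> lies in \<open>[-\<pi>, 3\<pi>]\<close>, whose points are
  at distance at most \<open>\<pi>\<close> from one of the multiples \<open>0\<close> and \<open>2\<pi>\<close>; two singular terms suffice.
\<close>

lemma norm_cis_diff_ge:
  assumes "- pi \<le> \<theta> - \<phi>" "\<theta> - \<phi> \<le> 3 * pi"
  shows "norm (cis \<phi> - cis \<theta>) \<ge> min \<bar>\<theta> - \<phi>\<bar> \<bar>\<theta> - (\<phi> + 2 * pi)\<bar> / 2"
proof -
  have "cis \<theta> - cis \<phi> = cis \<phi> * (exp (\<i> * of_real (\<theta> - \<phi>)) - 1)"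
    unfolding cis_conv_exp[symmetric] right_diff_distrib cis_mult by simp
  hence eq: "norm (cis \<phi> - cis \<theta>) = 2 * \<bar>sin ((\<theta> - \<phi>) / 2)\<bar>"
    by (subst norm_minus_commute) (simp only: norm_mult norm_cis dist_exp_i_1 mult_1)
  show ?thesis
  proof (cases "\<theta> - \<phi> \<le> pi")
    case True
    hence "\<bar>(\<theta> - \<phi>) / 2\<bar> \<le> pi / 2"
      using assms by (intro abs_leI) (simp_all add: field_simps)
    from abs_sin_ge_half_abs[OF this] show ?thesis
      unfolding eq by (simp add: min_le_iff_disj)
  next
    case False
    hence "\<bar>(\<theta> - (\<phi> + 2 * pi)) / 2\<bar> \<le> pi / 2"
      using assms by (intro abs_leI) (simp_all add: field_simps)
    note bound = abs_sin_ge_half_abs[OF this]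
    have "sin ((\<theta> - \<phi>) / 2) = - sin ((\<theta> - (\<phi> + 2 * pi)) / 2)"
      using sin_minus_pi[of "(\<theta> - \<phi>) / 2"]
      by (simp add: diff_divide_distrib add_divide_distrib diff_diff_add)
    with bound show ?thesis
      unfolding eq by (simp add: min_le_iff_disj)
  qed
qed

text \<open>
  Since \<open>1 - r \<le> \<bar>t - r * cis \<theta>\<bar>\<close>, moving \<open>r * cis \<theta>\<close> radially out to the circle at most doubles its
  distance to \<open>t\<close>. So one integrable function of \<open>\<theta>\<close> dominates the integrands for all \<open>r\<close>.
\<close>

lemma hardy_space_of_point_growth:
  assumes hol: "f holomorphic_on ball 0 1" and t: "norm t = 1"
    and growth: "\<And>z. norm z < 1 \<Longrightarrow> norm (f z) \<le> A * norm (t - z) powr - q"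
    and p: "p > 0" and q: "q \<ge> 0" "q * p < 1"
  shows "f \<in> hardy_space p"
proof -
  define s where "s = q * p"
  have s: "0 \<le> s" "s < 1" using p q by (auto simp: s_def)
  define \<phi> where "\<phi> = Arg t"
  have \<phi>: "t = cis \<phi>" "- pi < \<phi>" "\<phi> \<le> pi"
    using rcis_cmod_Arg[of t] Arg_bounded[of t] t by (simp_all add: \<phi>_def rcis_def)
  have A: "A \<ge> 0"
  proof -
    have "0 \<le> A * norm (t - 0) powr - q"
      by (rule order_trans[OF norm_ge_zero growth]) simp
    thus ?thesis using t by simp
  qed
  \<comment> \<open>The base \<open>4\<close> combines the factor \<open>2\<close> from moving to the circle with the \<open>2\<close> in
    \<open>norm_cis_diff_ge\<close>.\<close>
  define g where "g \<theta> = A powr p * 4 powr s *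
      (\<bar>\<theta> - \<phi>\<bar> powr - s + \<bar>\<theta> - (\<phi> + 2 * pi)\<bar> powr - s)" for \<theta>
  have g_int: "g integrable_on {0..2 * pi}"
    unfolding g_def by (intro integrable_on_mult_right integrable_add integrable_abs_powr s) auto
  have bound: "norm (f (of_real r * cis \<theta>)) powr p \<le> g \<theta>"
    if r: "0 \<le> r" "r < 1" and \<theta>: "\<theta> \<in> {0..2 * pi} - {\<phi>, \<phi> + 2 * pi}" for r \<theta>
  proof -
    define z where "z = of_real r * cis \<theta>"
    define x where "x = \<bar>\<theta> - \<phi>\<bar>"
    define y where "y = \<bar>\<theta> - (\<phi> + 2 * pi)\<bar>"
    have xy: "0 < x" "0 < y" using \<theta> by (auto simp: x_def y_def)
    have z: "norm z = r" using r by (simp add: z_def norm_mult)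
    have "norm (t - cis \<theta>) \<le> norm (t - z) + norm (z - cis \<theta>)"
      using norm_triangle_ineq[of "t - z" "z - cis \<theta>"] by simp
    also have "norm (z - cis \<theta>) = 1 - r"
    proof -
      have "z - cis \<theta> = of_real (r - 1) * cis \<theta>"
        by (simp add: z_def algebra_simps)
      thus ?thesis using r by (simp add: norm_mult del: of_real_diff)
    qed
    also have "1 - r \<le> norm (t - z)"
      using norm_triangle_ineq2[of t z] t z by simp
    finally have "min x y / 4 \<le> norm (t - z)"
      using norm_cis_diff_ge[of \<theta> \<phi>] \<phi> \<theta> by (auto simp: x_def y_def)
    hence tz: "norm (t - z) powr - s \<le> (min x y / 4) powr - s"
      using s xy by (intro powr_mono2') auto
    have "norm (f z) powr p \<le> (A * norm (t - z) powr - q) powr p"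
      using growth[of z] z r p by (intro powr_mono2) auto
    also have "\<dots> = A powr p * norm (t - z) powr - s"
      using A by (simp add: powr_mult powr_powr s_def)
    also have "\<dots> \<le> A powr p * (min x y / 4) powr - s"
      using tz by (intro mult_left_mono) auto
    also have "(min x y / 4) powr - s = 4 powr s * min x y powr - s"
      using xy by (simp add: powr_divide powr_minus field_simps)
    also have "min x y powr - s \<le> x powr - s + y powr - s"
      by (auto simp: min_def)
    finally show ?thesis
      by (simp add: g_def x_def y_def z_def mult.assoc mult_left_mono)
  qed
  have "1 / (2 * pi) * integral {0..2 * pi} (\<lambda>\<theta>. norm (f (of_real r * cis \<theta>)) powr p)
          \<le> 1 / (2 * pi) * integral {0..2 * pi} g" if r: "r \<in> {0..<1}" for r
  proof -
    define h where "h \<theta> = norm (f (of_real r * cis \<theta>)) powr p" for \<theta>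
    \<comment> \<open>At the singular angles \<open>0 powr (-s) = 0\<close> and \<open>g\<close> may be too small, so it is changed there.\<close>
    define g' where "g' \<theta> = (if \<theta> \<in> {\<phi>, \<phi> + 2 * pi} then h \<theta> else g \<theta>)" for \<theta>
    have "continuous_on {0..2 * pi} h"
      unfolding h_def
      by (intro continuous_on_powr' continuous_on_norm continuous_intros
            continuous_on_compose2[OF holomorphic_on_imp_continuous_on[OF hol]])
         (use r p in \<open>auto simp: norm_mult\<close>)
    hence "h integrable_on {0..2 * pi}"
      by (rule integrable_continuous_interval)
    moreover have "g' integrable_on {0..2 * pi}"
      by (rule integrable_spike_finite[OF _ _ g_int, of "{\<phi>, \<phi> + 2 * pi}"]) (auto simp: g'_def)
    moreover have "h \<theta> \<le> g' \<theta>" if "\<theta> \<in> {0..2 * pi}" for \<theta>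
      using bound[of r \<theta>] r that by (auto simp: g'_def h_def)
    ultimately have "integral {0..2 * pi} h \<le> integral {0..2 * pi} g'"
      by (rule integral_le)
    also have "\<dots> = integral {0..2 * pi} g"
      by (rule integral_spike[of "{\<phi>, \<phi> + 2 * pi}"]) (auto simp: g'_def)
    finally show ?thesis
      unfolding h_def by (intro mult_left_mono) auto
  qed
  thus ?thesis
    using hol unfolding hardy_space_def bdd_above_def by blast
qed


section \<open>Membership of the derivative in the Hardy space\<close>

theorem corollary2:
  fixes t :: complex and \<gamma> K p :: real and a :: "nat \<Rightarrow> complex"
  assumes "t \<in> sphere 0 1" and "\<gamma> > 1" and "K \<ge> 1"
    and "blaschke_sequence a"
    and "range a \<subseteq> region t \<gamma> K"
    and "0 < p" and "p < 1 / (2 * \<gamma>)"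
  shows "deriv (blaschke_product a) \<in> hardy_space p"
proof -
  define C where "C = 2 powr \<gamma> * (2 powr \<gamma> + K)"
  define S where "S = (\<Sum>n. 1 - norm (a n))"
  have t: "norm t = 1" using assms(1) by simp
  have an: "norm (a n) < 1" for n
    using assms(4) by (auto simp: blaschke_sequence_def)
  have sum: "summable (\<lambda>n. 1 - norm (a n))"
    using assms(4) by (auto simp: blaschke_sequence_def)
  have partial: "(\<Sum>n<N. (1 - norm (a n) ^ 2) / norm (1 - cnj (a n) * z) ^ 2)
      \<le> 2 * C\<^sup>2 * S * norm (t - z) powr - (2 * \<gamma>)" if z: "norm z < 1" for z N
  proof -
    define T where "T = norm (t - z) powr - (2 * \<gamma>)"
    have tz: "norm (t - z) > 0" using t z by auto
    have term_le: "(1 - norm (a n) ^ 2) / norm (1 - cnj (a n) * z) ^ 2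
        \<le> 2 * C\<^sup>2 * T * (1 - norm (a n))" for n
    proof -
      define d where "d = norm (1 - cnj (a n) * z)"
      have d: "d > 0" using one_minus_cnj_mult_nonzero[OF an z] by (simp add: d_def)
      have "norm (t - z) powr \<gamma> \<le> C * d"
        unfolding C_def d_def by (rule norm_powr_le_of_region) (use assms t z in auto)
      hence "(norm (t - z) powr \<gamma>)\<^sup>2 \<le> (C * d)\<^sup>2"
        by (intro power_mono) auto
      moreover have "(norm (t - z) powr \<gamma>)\<^sup>2 = 1 / T"
        using tz by (simp add: T_def powr_minus power2_eq_square field_simps flip: powr_add)
      ultimately have "1 / d\<^sup>2 \<le> C\<^sup>2 * T"
        using d tz by (simp add: T_def field_simps power_mult_distrib)
      moreover have "1 - norm (a n) ^ 2 \<le> 2 * (1 - norm (a n))"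
        using sum_squares_bound[of "norm (a n)" 1] by (simp add: power2_eq_square)
      moreover have "0 \<le> 1 - norm (a n) ^ 2"
        using an[of n] by (simp add: power_le_one)
      ultimately have "(1 - norm (a n) ^ 2) * (1 / d\<^sup>2) \<le> 2 * (1 - norm (a n)) * (C\<^sup>2 * T)"
        using an[of n] by (intro mult_mono) auto
      thus ?thesis by (simp add: d_def algebra_simps)
    qed
    have "(\<Sum>n<N. (1 - norm (a n) ^ 2) / norm (1 - cnj (a n) * z) ^ 2)
        \<le> (\<Sum>n<N. 2 * C\<^sup>2 * T * (1 - norm (a n)))"
      by (intro sum_mono term_le)
    also have "\<dots> = 2 * C\<^sup>2 * T * (\<Sum>n<N. 1 - norm (a n))"
      by (simp only: sum_distrib_left)
    also have "\<dots> \<le> 2 * C\<^sup>2 * T * S"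
      unfolding S_def using an
      by (intro mult_left_mono sum_le_suminf sum) (auto simp: T_def less_imp_le)
    finally show ?thesis by (simp add: T_def mult_ac)
  qed
  show ?thesis
  proof (rule hardy_space_of_point_growth[OF _ t])
    show "deriv (blaschke_product a) holomorphic_on ball 0 1"
      using assms(4) by (intro holomorphic_deriv holomorphic_on_blaschke_product) auto
    show "norm (deriv (blaschke_product a) z) \<le> 2 * C\<^sup>2 * S * norm (t - z) powr - (2 * \<gamma>)"
      if "norm z < 1" for z
      using norm_deriv_blaschke_product_le[OF assms(4) that partial[OF that]] .
    show "2 * \<gamma> * p < 1"
      using assms by (simp add: field_simps)
  qed (use assms in auto)
qed

end
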